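(* Let $R$ be a non-zero associative unital ring with center $C(R)$. Then $R$ is a $*$-prime left $R\otimes_{\mathbb{Z}} R^{op}$-module if and only if $C(R)$ is an integral domain and $C(R)$ is large in $R$.
   Context: $R$ is regarded as a bimodule over itself, i.e. as a left $R\otimes_{\mathbb{Z}} R^{op}$-module, whose submodules are the two-sided ideals of $R$. For a left module $M$ over a ring $T$ and submodules $N,L\subseteq M$, put $N*L = N\,\mathrm{Hom}_T(M,L)=\sum\{(N)f \mid f\in \mathrm{Hom}_T(M,L)\}$ (homomorphisms are written on the right of their arguments). $M$ is called $*$-prime if $N*L\neq 0$ for all non-zero submodules $N,L$ of $M$. A subring $R'$ of $R$ is large in $R$ if every non-zero two-sided ideal of $R$ contains a non-zero element of $R'$. *)

theory Defs
  imports
    "HOL-Algebra.Module"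
    "HOL-Algebra.QuotRing"
    "HOL-Algebra.Subrings"
    "HOL-Algebra.Generated_Groups"
    "HOL-Algebra.Free_Abelian_Groups"
begin

section \<open>Left modules over arbitrary rings\<close>

text \<open>The locale \<open>module\<close> of HOL-Algebra requires a commutative ring of scalars. The predicate
  \<open>submodule\<close> does not, and is used unchanged below.\<close>

locale left_module = R?: ring R + M?: abelian_group M
  for R :: "('t, 'k) ring_scheme" (structure) and M :: "('t, 'a, 'm) module_scheme" (structure) +
  assumes smult_closed [simp, intro]:
      "\<lbrakk>a \<in> carrier R; x \<in> carrier M\<rbrakk> \<Longrightarrow> a \<odot>\<^bsub>M\<^esub> x \<in> carrier M"
    and smult_l_distr:
      "\<lbrakk>a \<in> carrier R; b \<in> carrier R; x \<in> carrier M\<rbrakk> \<Longrightarrow>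
      (a \<oplus> b) \<odot>\<^bsub>M\<^esub> x = a \<odot>\<^bsub>M\<^esub> x \<oplus>\<^bsub>M\<^esub> b \<odot>\<^bsub>M\<^esub> x"
    and smult_r_distr:
      "\<lbrakk>a \<in> carrier R; x \<in> carrier M; y \<in> carrier M\<rbrakk> \<Longrightarrow>
      a \<odot>\<^bsub>M\<^esub> (x \<oplus>\<^bsub>M\<^esub> y) = a \<odot>\<^bsub>M\<^esub> x \<oplus>\<^bsub>M\<^esub> a \<odot>\<^bsub>M\<^esub> y"
    and smult_assoc1:
      "\<lbrakk>a \<in> carrier R; b \<in> carrier R; x \<in> carrier M\<rbrakk> \<Longrightarrow>
      (a \<otimes> b) \<odot>\<^bsub>M\<^esub> x = a \<odot>\<^bsub>M\<^esub> (b \<odot>\<^bsub>M\<^esub> x)"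
    and smult_one [simp]:
      "x \<in> carrier M \<Longrightarrow> \<one> \<odot>\<^bsub>M\<^esub> x = x"

definition Hom_mod ::
  "('t, 'k) ring_scheme \<Rightarrow> ('t, 'a, 'm) module_scheme \<Rightarrow> ('t, 'b, 'n) module_scheme \<Rightarrow> ('a \<Rightarrow> 'b) set"
  where "Hom_mod T M N =
    {f \<in> hom (add_monoid M) (add_monoid N).
      \<forall>t \<in> carrier T. \<forall>x \<in> carrier M. f (t \<odot>\<^bsub>M\<^esub> x) = t \<odot>\<^bsub>N\<^esub> f x}"

text \<open>The sum of the family of subgroups \<open>f ` N\<close> is the additive subgroup generated by their union.\<close>

definition star_prod ::
  "('t, 'k) ring_scheme \<Rightarrow> ('t, 'a, 'm) module_scheme \<Rightarrow> 'a set \<Rightarrow> 'a set \<Rightarrow> 'a set"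
  where "star_prod T M N L =
    generate (add_monoid M) (\<Union>f \<in> Hom_mod T M (M\<lparr>carrier := L\<rparr>). f ` N)"

definition star_prime :: "('t, 'k) ring_scheme \<Rightarrow> ('t, 'a, 'm) module_scheme \<Rightarrow> bool"
  where "star_prime T M \<longleftrightarrow> left_module T M \<and>
    (\<forall>N L. submodule N T M \<longrightarrow> submodule L T M \<longrightarrow> N \<noteq> {\<zero>\<^bsub>M\<^esub>} \<longrightarrow> L \<noteq> {\<zero>\<^bsub>M\<^esub>} \<longrightarrow>
      star_prod T M N L \<noteq> {\<zero>\<^bsub>M\<^esub>})"


section \<open>Centre and large subrings\<close>

definition ring_center :: "('a, 'm) ring_scheme \<Rightarrow> 'a set"
  where "ring_center R = {c \<in> carrier R. \<forall>r \<in> carrier R. c \<otimes>\<^bsub>R\<^esub> r = r \<otimes>\<^bsub>R\<^esub> c}"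

definition large_subring :: "'a set \<Rightarrow> ('a, 'm) ring_scheme \<Rightarrow> bool"
  where "large_subring S R \<longleftrightarrow> subring S R \<and>
    (\<forall>I. ideal I R \<longrightarrow> I \<noteq> {\<zero>\<^bsub>R\<^esub>} \<longrightarrow> (\<exists>x \<in> I \<inter> S. x \<noteq> \<zero>\<^bsub>R\<^esub>))"


section \<open>The tensor product of two rings over the integers\<close>

definition opposite_ring :: "('a, 'm) ring_scheme \<Rightarrow> ('a, 'm) ring_scheme"
  where "opposite_ring R = R\<lparr>mult := (\<lambda>x y. y \<otimes>\<^bsub>R\<^esub> x)\<rparr>"

text \<open>The additive group of \<open>tensor_free R S\<close> is the free abelian group on
  \<open>carrier R \<times> carrier S\<close>; the product is the biadditive extension of
  \<open>(a, b) (c, d) = (a c, b d)\<close>. The tensor product is its quotient by the additive subgroup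
  generated by the biadditivity relations, with the induced product.\<close>

definition tensor_free ::
  "('a, 'm) ring_scheme \<Rightarrow> ('b, 'n) ring_scheme \<Rightarrow> (('a \<times> 'b) \<Rightarrow>\<^sub>0 int) ring"
  where "tensor_free R S =
    \<lparr>carrier = carrier (free_Abelian_group (carrier R \<times> carrier S)),
     mult = (\<lambda>u v. frag_extend
        (\<lambda>p. frag_extend (\<lambda>q. frag_of (fst p \<otimes>\<^bsub>R\<^esub> fst q, snd p \<otimes>\<^bsub>S\<^esub> snd q)) v) u),
     one = frag_of (\<one>\<^bsub>R\<^esub>, \<one>\<^bsub>S\<^esub>),
     ring.zero = 0,
     add = (+)\<rparr>"

definition tensor_relations ::
  "('a, 'm) ring_scheme \<Rightarrow> ('b, 'n) ring_scheme \<Rightarrow> (('a \<times> 'b) \<Rightarrow>\<^sub>0 int) set"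
  where "tensor_relations R S =
    {frag_of (a \<oplus>\<^bsub>R\<^esub> a', b) - frag_of (a, b) - frag_of (a', b) | a a' b.
       a \<in> carrier R \<and> a' \<in> carrier R \<and> b \<in> carrier S} \<union>
    {frag_of (a, b \<oplus>\<^bsub>S\<^esub> b') - frag_of (a, b) - frag_of (a, b') | a b b'.
       a \<in> carrier R \<and> b \<in> carrier S \<and> b' \<in> carrier S}"

definition tensor_kernel ::
  "('a, 'm) ring_scheme \<Rightarrow> ('b, 'n) ring_scheme \<Rightarrow> (('a \<times> 'b) \<Rightarrow>\<^sub>0 int) set"
  where "tensor_kernel R S = generate (add_monoid (tensor_free R S)) (tensor_relations R S)"

definition tensor_ring ::
  "('a, 'm) ring_scheme \<Rightarrow> ('b, 'n) ring_scheme \<Rightarrow> (('a \<times> 'b) \<Rightarrow>\<^sub>0 int) set ring"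
  where "tensor_ring R S = tensor_free R S Quot tensor_kernel R S"

definition pure_tensor ::
  "('a, 'm) ring_scheme \<Rightarrow> ('b, 'n) ring_scheme \<Rightarrow> 'a \<Rightarrow> 'b \<Rightarrow> (('a \<times> 'b) \<Rightarrow>\<^sub>0 int) set"
  where "pure_tensor R S a b = tensor_kernel R S +>\<^bsub>tensor_free R S\<^esub> frag_of (a, b)"


section \<open>A ring as a bimodule over itself\<close>

definition enveloping_ring :: "('a, 'm) ring_scheme \<Rightarrow> (('a \<times> 'a) \<Rightarrow>\<^sub>0 int) set ring"
  where "enveloping_ring R = tensor_ring R (opposite_ring R)"

definition free_action :: "('a, 'm) ring_scheme \<Rightarrow> (('a \<times> 'a) \<Rightarrow>\<^sub>0 int) \<Rightarrow> 'a \<Rightarrow> 'a"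
  where "free_action R u x =
    finsum R (\<lambda>p. [Poly_Mapping.lookup u p] \<cdot>\<^bsub>R\<^esub> (fst p \<otimes>\<^bsub>R\<^esub> x \<otimes>\<^bsub>R\<^esub> snd p)) (Poly_Mapping.keys u)"

text \<open>The scalar product is determined by \<open>(a \<otimes> b) x = a x b\<close>, see \<open>smult_pure_tensor\<close>. It is
  computed on representatives; all representatives of a coset give the same value.\<close>

definition regular_bimodule ::
  "('a, 'm) ring_scheme \<Rightarrow> ((('a \<times> 'a) \<Rightarrow>\<^sub>0 int) set, 'a) module"
  where "regular_bimodule R =
    \<lparr>carrier = carrier R, mult = mult R, one = one R, ring.zero = \<zero>\<^bsub>R\<^esub>, add = add R,
     smult = (\<lambda>A x. the_elem ((\<lambda>u. free_action R u x) ` A))\<rparr>"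



section \<open>Well-definedness\<close>

lemma ring_opposite_ring:
  assumes "ring R" shows "ring (opposite_ring R)"
proof -
  interpret ring R by fact
  have "abelian_group (opposite_ring R)"
    using abelian_group_axioms
    by (simp add: opposite_ring_def abelian_group_def abelian_monoid_def abelian_group_axioms_def)
  moreover have "Group.monoid (opposite_ring R)"
    by (rule monoidI) (auto simp: opposite_ring_def m_assoc)
  ultimately show ?thesis
    by (rule ringI) (auto simp: opposite_ring_def l_distr r_distr)
qed

lemma tensor_free_simps [simp]:
  "carrier (tensor_free R S) = {u. Poly_Mapping.keys u \<subseteq> carrier R \<times> carrier S}"
  "\<one>\<^bsub>tensor_free R S\<^esub> = frag_of (\<one>\<^bsub>R\<^esub>, \<one>\<^bsub>S\<^esub>)"
  "\<zero>\<^bsub>tensor_free R S\<^esub> = 0"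
  "u \<oplus>\<^bsub>tensor_free R S\<^esub> v = u + v"
  by (auto simp: tensor_free_def)

lemma add_monoid_tensor_free:
  "add_monoid (tensor_free R S) = free_Abelian_group (carrier R \<times> carrier S)"
  by (simp add: tensor_free_def free_Abelian_group_def)

lemma frag_induction_keys [consumes 1, case_names zero one diff]:
  assumes "Poly_Mapping.keys c \<subseteq> S"
    and "P 0" and "\<And>x. x \<in> S \<Longrightarrow> P (frag_of x)"
    and "\<And>a b. Poly_Mapping.keys a \<subseteq> S \<Longrightarrow> Poly_Mapping.keys b \<subseteq> S \<Longrightarrow> P a \<Longrightarrow> P b \<Longrightarrow> P (a - b)"
  shows "P c"
proof -
  have "Poly_Mapping.keys c \<subseteq> S \<and> P c"
    using assms(1)
  proof (induction c rule: frag_induction)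
    case (diff a b)
    then show ?case using keys_diff[of a b] assms(4) by auto
  qed (use assms in auto)
  then show ?thesis ..
qed

lemma frag_extend_add_fun:
  "frag_extend (\<lambda>p. f p + g p) u = frag_extend f u + frag_extend g u"
  by (simp add: frag_extend_def frag_cmul_distrib2 sum.distrib)

lemma frag_extend_diff_fun:
  "frag_extend (\<lambda>p. f p - g p) u = frag_extend f u - frag_extend g u"
proof -
  have "frag_extend f u = frag_extend (\<lambda>p. (f p - g p) + g p) u" by simp
  then show ?thesis unfolding frag_extend_add_fun by (simp add: algebra_simps)
qed

lemma tensor_mult_add:
  "(u + u') \<otimes>\<^bsub>tensor_free R S\<^esub> v = u \<otimes>\<^bsub>tensor_free R S\<^esub> v + u' \<otimes>\<^bsub>tensor_free R S\<^esub> v"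
  "u \<otimes>\<^bsub>tensor_free R S\<^esub> (v + v') = u \<otimes>\<^bsub>tensor_free R S\<^esub> v + u \<otimes>\<^bsub>tensor_free R S\<^esub> v'"
  by (simp_all add: tensor_free_def frag_extend_add frag_extend_add_fun)

lemma tensor_mult_diff:
  "(u - u') \<otimes>\<^bsub>tensor_free R S\<^esub> v = u \<otimes>\<^bsub>tensor_free R S\<^esub> v - u' \<otimes>\<^bsub>tensor_free R S\<^esub> v"
  "u \<otimes>\<^bsub>tensor_free R S\<^esub> (v - v') = u \<otimes>\<^bsub>tensor_free R S\<^esub> v - u \<otimes>\<^bsub>tensor_free R S\<^esub> v'"
  by (simp_all add: tensor_free_def frag_extend_diff frag_extend_diff_fun)

lemma tensor_mult_zero:
  "0 \<otimes>\<^bsub>tensor_free R S\<^esub> v = 0" "u \<otimes>\<^bsub>tensor_free R S\<^esub> 0 = 0"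
  using tensor_mult_diff(1)[of R S 0 0 v] tensor_mult_diff(2)[of R S u 0 0] by simp_all

lemma tensor_mult_minus:
  "(- u) \<otimes>\<^bsub>tensor_free R S\<^esub> v = - (u \<otimes>\<^bsub>tensor_free R S\<^esub> v)"
  "u \<otimes>\<^bsub>tensor_free R S\<^esub> (- v) = - (u \<otimes>\<^bsub>tensor_free R S\<^esub> v)"
  using tensor_mult_diff(1)[of R S 0 u v] tensor_mult_diff(2)[of R S u 0 v]
  by (simp_all add: tensor_mult_zero)

lemma tensor_mult_of:
  "frag_of (a, b) \<otimes>\<^bsub>tensor_free R S\<^esub> frag_of (c, d) = frag_of (a \<otimes>\<^bsub>R\<^esub> c, b \<otimes>\<^bsub>S\<^esub> d)"
  by (simp add: tensor_free_def)

lemma ring_tensor_free: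
  assumes "ring R" "ring S" shows "ring (tensor_free R S)"
proof (rule ringI)
  interpret R: ring R by fact
  interpret S: ring S by fact
  let ?F = "tensor_free R S" and ?C = "carrier R \<times> carrier S"
  show "abelian_group ?F"
    by (rule comm_group_abelian_groupI)
      (simp only: add_monoid_tensor_free abelian_free_Abelian_group)
  show "Group.monoid ?F"
  proof (rule monoidI)
    fix u v assume u: "u \<in> carrier ?F" and v: "v \<in> carrier ?F"
    have "Poly_Mapping.keys u \<subseteq> ?C" "Poly_Mapping.keys v \<subseteq> ?C" using u v by auto
    then show "u \<otimes>\<^bsub>?F\<^esub> v \<in> carrier ?F"
    proof (induction u rule: frag_induction_keys)
      case (one p)
      from \<open>Poly_Mapping.keys v \<subseteq> ?C\<close> show ?case
      proof (induction v rule: frag_induction_keys)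
        case (one q)
        then show ?case using \<open>p \<in> ?C\<close> by (cases p; cases q) (auto simp: tensor_mult_of)
      next
        case (diff a b)
        then show ?case using keys_diff by (fastforce simp: tensor_mult_diff)
      qed (simp add: tensor_mult_zero)
    next
      case (diff a b)
      then show ?case using keys_diff by (fastforce simp: tensor_mult_diff)
    qed (simp add: tensor_mult_zero)
  next
    fix u v w assume "u \<in> carrier ?F" "v \<in> carrier ?F" "w \<in> carrier ?F"
    then have "Poly_Mapping.keys u \<subseteq> ?C" and v: "Poly_Mapping.keys v \<subseteq> ?C"
      and w: "Poly_Mapping.keys w \<subseteq> ?C" by auto
    then show "u \<otimes>\<^bsub>?F\<^esub> v \<otimes>\<^bsub>?F\<^esub> w = u \<otimes>\<^bsub>?F\<^esub> (v \<otimes>\<^bsub>?F\<^esub> w)"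
    proof (induction u rule: frag_induction_keys)
      case p: (one p)
      from v show ?case
      proof (induction v rule: frag_induction_keys)
        case q: (one q)
        from w show ?case
        proof (induction w rule: frag_induction_keys)
          case r: (one r)
          then show ?case using p q
            by (cases p; cases q; cases r) (auto simp: tensor_mult_of R.m_assoc S.m_assoc)
        qed (simp_all add: tensor_mult_zero tensor_mult_diff)
      qed (simp_all add: tensor_mult_zero tensor_mult_diff)
    qed (simp_all add: tensor_mult_zero tensor_mult_diff)
  next
    fix u assume "u \<in> carrier ?F"
    then have u: "Poly_Mapping.keys u \<subseteq> ?C" by auto
    from u show "\<one>\<^bsub>?F\<^esub> \<otimes>\<^bsub>?F\<^esub> u = u"
    proof (induction u rule: frag_induction_keys)
      case (one p)
      then show ?case by (cases p) (auto simp: tensor_mult_of)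
    qed (simp_all add: tensor_mult_zero tensor_mult_diff)
    from u show "u \<otimes>\<^bsub>?F\<^esub> \<one>\<^bsub>?F\<^esub> = u"
    proof (induction u rule: frag_induction_keys)
      case (one p)
      then show ?case by (cases p) (auto simp: tensor_mult_of)
    qed (simp_all add: tensor_mult_zero tensor_mult_diff)
  qed auto
qed (simp_all add: tensor_mult_add)

lemma tensor_relations_subset:
  assumes "ring R" "ring S"
  shows "tensor_relations R S \<subseteq> carrier (tensor_free R S)"
proof -
  interpret R: ring R by fact
  interpret S: ring S by fact
  show ?thesis
    unfolding tensor_relations_def
    by (auto dest!: subsetD[OF keys_diff])
qed

lemma tensor_relationsI:
  "a \<in> carrier R \<Longrightarrow> a' \<in> carrier R \<Longrightarrow> b \<in> carrier S \<Longrightarrow>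
    frag_of (a \<oplus>\<^bsub>R\<^esub> a', b) - frag_of (a, b) - frag_of (a', b) \<in> tensor_relations R S"
  "a \<in> carrier R \<Longrightarrow> b \<in> carrier S \<Longrightarrow> b' \<in> carrier S \<Longrightarrow>
    frag_of (a, b \<oplus>\<^bsub>S\<^esub> b') - frag_of (a, b) - frag_of (a, b') \<in> tensor_relations R S"
  unfolding tensor_relations_def by blast+

lemma tensor_relationsE:
  assumes "t \<in> tensor_relations R S"
  obtains a a' b where "a \<in> carrier R" "a' \<in> carrier R" "b \<in> carrier S"
      "t = frag_of (a \<oplus>\<^bsub>R\<^esub> a', b) - frag_of (a, b) - frag_of (a', b)"
    | a b b' where "a \<in> carrier R" "b \<in> carrier S" "b' \<in> carrier S"
      "t = frag_of (a, b \<oplus>\<^bsub>S\<^esub> b') - frag_of (a, b) - frag_of (a, b')"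
  using assms unfolding tensor_relations_def by blast

lemma tensor_relations_mult:
  assumes "ring R" "ring S" "t \<in> tensor_relations R S" "p \<in> carrier R \<times> carrier S"
  shows "frag_of p \<otimes>\<^bsub>tensor_free R S\<^esub> t \<in> tensor_relations R S"
    and "t \<otimes>\<^bsub>tensor_free R S\<^esub> frag_of p \<in> tensor_relations R S"
proof -
  interpret R: ring R by fact
  interpret S: ring S by fact
  obtain c d where p: "p = (c, d)" "c \<in> carrier R" "d \<in> carrier S" using assms(4) by auto
  from assms(3) have "frag_of p \<otimes>\<^bsub>tensor_free R S\<^esub> t \<in> tensor_relations R S \<and>
      t \<otimes>\<^bsub>tensor_free R S\<^esub> frag_of p \<in> tensor_relations R S"
    by (cases rule: tensor_relationsE)
      (use p in \<open>simp_all add: tensor_mult_diff tensor_mult_of tensor_relationsI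
        R.l_distr R.r_distr S.l_distr S.r_distr\<close>)
  then show "frag_of p \<otimes>\<^bsub>tensor_free R S\<^esub> t \<in> tensor_relations R S"
    and "t \<otimes>\<^bsub>tensor_free R S\<^esub> frag_of p \<in> tensor_relations R S" by auto
qed

lemma tensor_kernel_ideal:
  assumes "ring R" "ring S" shows "ideal (tensor_kernel R S) (tensor_free R S)"
proof -
  let ?F = "tensor_free R S" and ?C = "carrier R \<times> carrier S" and ?K = "tensor_kernel R S"
  interpret F: ring ?F by (rule ring_tensor_free[OF assms])
  note sub = tensor_relations_subset[OF assms]
  have K: "subgroup ?K (add_monoid ?F)"
    unfolding tensor_kernel_def by (rule F.add.generate_is_subgroup) (use sub in simp)
  have K0: "0 \<in> ?K" using subgroup.one_closed[OF K] by simp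
  have Kadd: "x + y \<in> ?K" if "x \<in> ?K" "y \<in> ?K" for x y
    using subgroup.m_closed[OF K that] by simp
  have minus: "\<ominus>\<^bsub>?F\<^esub> x = - x" if "x \<in> carrier ?F" for x
    using that unfolding a_inv_def add_monoid_tensor_free by simp
  have Kminus: "- x \<in> ?K" if "x \<in> ?K" for x
    using subgroup.m_inv_closed[OF K that] subgroup.subset[OF K] that minus
    by (auto simp: a_inv_def)
  have Kdiff: "x - y \<in> ?K" if "x \<in> ?K" "y \<in> ?K" for x y
    using Kadd[OF that(1) Kminus[OF that(2)]] by simp
  have incl: "x \<in> ?K" if "x \<in> tensor_relations R S" for x
    using that unfolding tensor_kernel_def by (rule generate.incl)
  have gen: "frag_of p \<otimes>\<^bsub>?F\<^esub> k \<in> ?K \<and> k \<otimes>\<^bsub>?F\<^esub> frag_of p \<in> ?K"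
    if "k \<in> ?K" and p: "p \<in> ?C" for k p
    using that(1) unfolding tensor_kernel_def
  proof (induction rule: generate.induct)
    case one
    then show ?case using K0 unfolding tensor_kernel_def[symmetric] by (simp add: tensor_mult_zero)
  next
    case (incl h)
    then show ?case
      using tensor_relations_mult[OF assms incl p] by (auto intro: generate.incl)
  next
    case (inv h)
    have "inv\<^bsub>add_monoid ?F\<^esub> h = - h" using minus sub inv by (auto simp: a_inv_def)
    then show ?case
      using tensor_relations_mult[OF assms inv p, THEN incl] Kminus
      unfolding tensor_kernel_def[symmetric] by (simp only: tensor_mult_minus)
  next
    case (eng h1 h2)
    then show ?case
      using Kadd unfolding tensor_kernel_def[symmetric] by (simp add: tensor_mult_add)
  qed
  show ?thesis
  proof (rule idealI)
    fix k u assume k: "k \<in> ?K" and "u \<in> carrier ?F"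
    then have u: "Poly_Mapping.keys u \<subseteq> ?C" by simp
    from u show "u \<otimes>\<^bsub>?F\<^esub> k \<in> ?K"
      by (induction u rule: frag_induction_keys)
        (simp_all add: tensor_mult_zero tensor_mult_diff K0 Kdiff gen k)
    from u show "k \<otimes>\<^bsub>?F\<^esub> u \<in> ?K"
      by (induction u rule: frag_induction_keys)
        (simp_all add: tensor_mult_zero tensor_mult_diff K0 Kdiff gen k)
  qed (use K F.ring_axioms in auto)
qed

lemma ring_tensor_ring:
  assumes "ring R" "ring S" shows "ring (tensor_ring R S)"
  unfolding tensor_ring_def by (rule ideal.quotient_is_ring[OF tensor_kernel_ideal[OF assms]])

lemma ring_enveloping_ring: "ring R \<Longrightarrow> ring (enveloping_ring R)"
  unfolding enveloping_ring_def by (intro ring_tensor_ring ring_opposite_ring)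

lemma free_action_superset:
  assumes "ring R" "finite P" "P \<subseteq> carrier R \<times> carrier R"
    "Poly_Mapping.keys u \<subseteq> P" "x \<in> carrier R"
  shows "free_action R u x =
    finsum R (\<lambda>p. [Poly_Mapping.lookup u p] \<cdot>\<^bsub>R\<^esub> (fst p \<otimes>\<^bsub>R\<^esub> x \<otimes>\<^bsub>R\<^esub> snd p)) P"
proof -
  interpret ring R by fact
  have zero: "[(0::int)] \<cdot>\<^bsub>R\<^esub> y = \<zero>\<^bsub>R\<^esub>" for y by (simp add: add_pow_def)
  show ?thesis
    unfolding free_action_def
    by (rule add.finprod_mono_neutral_cong_left)
      (use assms in \<open>auto simp: in_keys_iff zero intro!: add.int_pow_closed\<close>)
qed

lemma free_action_closed:
  assumes "ring R" "Poly_Mapping.keys u \<subseteq> carrier R \<times> carrier R" "x \<in> carrier R"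
  shows "free_action R u x \<in> carrier R"
proof -
  interpret ring R by fact
  show ?thesis unfolding free_action_def
    by (rule finsum_closed) (use assms in \<open>auto intro!: add.int_pow_closed\<close>)
qed

lemma free_action_of:
  assumes "ring R" "a \<in> carrier R" "b \<in> carrier R" "x \<in> carrier R"
  shows "free_action R (frag_of (a, b)) x = a \<otimes>\<^bsub>R\<^esub> x \<otimes>\<^bsub>R\<^esub> b"
proof -
  interpret ring R by fact
  show ?thesis using assms
    by (simp add: free_action_def keys_frag_of add.int_pow_1)
qed

lemma free_action_zero: "ring R \<Longrightarrow> free_action R 0 x = \<zero>\<^bsub>R\<^esub>"
proof -
  assume "ring R"
  then interpret ring R .
  show ?thesis by (simp add: free_action_def)
qed

lemma free_action_add:
  assumes "ring R" "Poly_Mapping.keys u \<subseteq> carrier R \<times> carrier R"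
    "Poly_Mapping.keys v \<subseteq> carrier R \<times> carrier R" "x \<in> carrier R"
  shows "free_action R (u + v) x = free_action R u x \<oplus>\<^bsub>R\<^esub> free_action R v x"
proof -
  interpret ring R by fact
  let ?P = "Poly_Mapping.keys u \<union> Poly_Mapping.keys v"
  let ?m = "\<lambda>p. fst p \<otimes>\<^bsub>R\<^esub> x \<otimes>\<^bsub>R\<^esub> snd p"
  have P: "finite ?P" "?P \<subseteq> carrier R \<times> carrier R" using assms by auto
  have m: "?m p \<in> carrier R" if "p \<in> ?P" for p using that P assms(4) by auto
  have "free_action R (u + v) x =
      finsum R (\<lambda>p. [Poly_Mapping.lookup (u + v) p] \<cdot>\<^bsub>R\<^esub> ?m p) ?P"
    by (rule free_action_superset) (use assms P keys_add[of u v] in auto)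
  also have "\<dots> = finsum R (\<lambda>p. [Poly_Mapping.lookup u p] \<cdot>\<^bsub>R\<^esub> ?m p
      \<oplus>\<^bsub>R\<^esub> [Poly_Mapping.lookup v p] \<cdot>\<^bsub>R\<^esub> ?m p) ?P"
    by (rule finsum_cong')
      (use m in \<open>auto simp: lookup_add add.int_pow_mult intro!: add.int_pow_closed\<close>)
  also have "\<dots> = finsum R (\<lambda>p. [Poly_Mapping.lookup u p] \<cdot>\<^bsub>R\<^esub> ?m p) ?P
      \<oplus>\<^bsub>R\<^esub> finsum R (\<lambda>p. [Poly_Mapping.lookup v p] \<cdot>\<^bsub>R\<^esub> ?m p) ?P"
    by (rule finsum_addf) (use m in \<open>auto intro!: add.int_pow_closed\<close>)
  also have "\<dots> = free_action R u x \<oplus>\<^bsub>R\<^esub> free_action R v x"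
    using free_action_superset[of R ?P u x] free_action_superset[of R ?P v x] assms P by auto
  finally show ?thesis .
qed

lemma free_action_diff:
  assumes "ring R" "Poly_Mapping.keys u \<subseteq> carrier R \<times> carrier R"
    "Poly_Mapping.keys v \<subseteq> carrier R \<times> carrier R" "x \<in> carrier R"
  shows "free_action R (u - v) x = free_action R u x \<ominus>\<^bsub>R\<^esub> free_action R v x"
proof -
  interpret ring R by fact
  have k: "Poly_Mapping.keys (u - v) \<subseteq> carrier R \<times> carrier R"
    using keys_diff[of u v] assms by auto
  have "free_action R u x = free_action R (u - v) x \<oplus>\<^bsub>R\<^esub> free_action R v x"
    using free_action_add[OF assms(1) k assms(3,4)] by simp
  moreover have "free_action R (u - v) x \<in> carrier R" "free_action R v x \<in> carrier R"
    by (rule free_action_closed; use assms k in simp)+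
  ultimately show ?thesis by (simp add: a_minus_def a_assoc r_neg)
qed

lemma free_action_distrib:
  assumes "ring R" "Poly_Mapping.keys u \<subseteq> carrier R \<times> carrier R" "x \<in> carrier R" "y \<in> carrier R"
  shows "free_action R u (x \<oplus>\<^bsub>R\<^esub> y) = free_action R u x \<oplus>\<^bsub>R\<^esub> free_action R u y"
proof -
  interpret ring R by fact
  let ?m = "\<lambda>x p. fst p \<otimes>\<^bsub>R\<^esub> x \<otimes>\<^bsub>R\<^esub> snd p"
  have m: "?m z p \<in> carrier R" if "p \<in> Poly_Mapping.keys u" "z \<in> carrier R" for p z
    using that assms by auto
  have "?m (x \<oplus>\<^bsub>R\<^esub> y) p = ?m x p \<oplus>\<^bsub>R\<^esub> ?m y p" if "p \<in> Poly_Mapping.keys u" for p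
    using that assms by (auto simp: l_distr r_distr)
  then have "free_action R u (x \<oplus>\<^bsub>R\<^esub> y) =
      finsum R (\<lambda>p. [Poly_Mapping.lookup u p] \<cdot>\<^bsub>R\<^esub> ?m x p
        \<oplus>\<^bsub>R\<^esub> [Poly_Mapping.lookup u p] \<cdot>\<^bsub>R\<^esub> ?m y p) (Poly_Mapping.keys u)"
    unfolding free_action_def
    by (intro finsum_cong') (use m assms in \<open>auto simp: add.int_pow_distrib intro!: add.int_pow_closed\<close>)
  also have "\<dots> = free_action R u x \<oplus>\<^bsub>R\<^esub> free_action R u y"
    unfolding free_action_def
    by (rule finsum_addf) (use m assms in \<open>auto intro!: add.int_pow_closed\<close>)
  finally show ?thesis .
qed

lemma opposite_ring_simps [simp]:
  "carrier (opposite_ring R) = carrier R" "\<one>\<^bsub>opposite_ring R\<^esub> = \<one>\<^bsub>R\<^esub>"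
  "\<zero>\<^bsub>opposite_ring R\<^esub> = \<zero>\<^bsub>R\<^esub>" "x \<oplus>\<^bsub>opposite_ring R\<^esub> y = x \<oplus>\<^bsub>R\<^esub> y"
  "x \<otimes>\<^bsub>opposite_ring R\<^esub> y = y \<otimes>\<^bsub>R\<^esub> x"
  by (simp_all add: opposite_ring_def)

lemma free_action_minus_right:
  assumes "ring R" "Poly_Mapping.keys u \<subseteq> carrier R \<times> carrier R" "x \<in> carrier R" "y \<in> carrier R"
  shows "free_action R u (x \<ominus>\<^bsub>R\<^esub> y) = free_action R u x \<ominus>\<^bsub>R\<^esub> free_action R u y"
proof -
  interpret ring R by fact
  have "free_action R u ((x \<ominus>\<^bsub>R\<^esub> y) \<oplus>\<^bsub>R\<^esub> y) = free_action R u (x \<ominus>\<^bsub>R\<^esub> y) \<oplus>\<^bsub>R\<^esub> free_action R u y"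
    by (rule free_action_distrib) (use assms in auto)
  moreover have "(x \<ominus>\<^bsub>R\<^esub> y) \<oplus>\<^bsub>R\<^esub> y = x" using assms by (simp add: a_minus_def a_assoc l_neg)
  moreover have "free_action R u (x \<ominus>\<^bsub>R\<^esub> y) \<in> carrier R" "free_action R u y \<in> carrier R"
    using assms by (auto intro: free_action_closed)
  ultimately show ?thesis by (simp add: a_minus_def a_assoc r_neg)
qed

lemma free_action_mult:
  assumes "ring R" "Poly_Mapping.keys u \<subseteq> carrier R \<times> carrier R"
    "Poly_Mapping.keys v \<subseteq> carrier R \<times> carrier R" "x \<in> carrier R"
  shows "free_action R (u \<otimes>\<^bsub>tensor_free R (opposite_ring R)\<^esub> v) x =
    free_action R u (free_action R v x)"
proof -
  interpret ring R by fact
  let ?F = "tensor_free R (opposite_ring R)" and ?C = "carrier R \<times> carrier R"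
  interpret F: ring ?F by (intro ring_tensor_free ring_opposite_ring assms(1))
  have cl: "Poly_Mapping.keys (a \<otimes>\<^bsub>?F\<^esub> b) \<subseteq> ?C"
    if "Poly_Mapping.keys a \<subseteq> ?C" "Poly_Mapping.keys b \<subseteq> ?C" for a b
    using F.m_closed[of a b] that by simp
  note ac = free_action_closed[OF assms(1) _ assms(4)]
  show ?thesis using assms(2)
  proof (induction u rule: frag_induction_keys)
    case zero
    then show ?case using assms by (simp add: free_action_zero tensor_mult_zero)
  next
    case p: (one p)
    have kp: "Poly_Mapping.keys (frag_of p) \<subseteq> ?C" using p by simp
    from assms(3) show ?case
    proof (induction v rule: frag_induction_keys)
      case zero
      show ?case using p assms by (cases p) (auto simp: free_action_zero tensor_mult_zero free_action_of)
    next
      case (one q)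
      then show ?case using p assms
        by (cases p; cases q) (auto simp: tensor_mult_of free_action_of m_assoc)
    next
      case (diff a b)
      then show ?case using assms kp
        by (simp add: tensor_mult_diff free_action_diff cl ac free_action_minus_right)
    qed
  next
    case (diff a b)
    then show ?case using assms
      by (simp add: tensor_mult_diff free_action_diff cl ac)
  qed
qed

lemma free_action_kernel:
  assumes "ring R" "k \<in> tensor_kernel R (opposite_ring R)" "x \<in> carrier R"
  shows "free_action R k x = \<zero>\<^bsub>R\<^esub>"
proof -
  interpret ring R by fact
  let ?S = "opposite_ring R"
  let ?F = "tensor_free R ?S" and ?C = "carrier R \<times> carrier R"
  have opp: "ring ?S" by (rule ring_opposite_ring[OF assms(1)])
  interpret F: ring ?F by (rule ring_tensor_free[OF assms(1) opp])
  have sub: "tensor_relations R ?S \<subseteq> {u. Poly_Mapping.keys u \<subseteq> ?C}"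
    using tensor_relations_subset[OF assms(1) opp] by simp
  have rel: "free_action R h x = \<zero>\<^bsub>R\<^esub>" if "h \<in> tensor_relations R ?S" for h
  proof -
    have *: "free_action R (frag_of p - frag_of q - frag_of r) x =
        free_action R (frag_of p) x \<ominus>\<^bsub>R\<^esub> free_action R (frag_of q) x \<ominus>\<^bsub>R\<^esub> free_action R (frag_of r) x"
      if "p \<in> ?C" "q \<in> ?C" "r \<in> ?C" for p q r
    proof -
      have "Poly_Mapping.keys (frag_of p - frag_of q) \<subseteq> ?C"
        using keys_diff[of "frag_of p" "frag_of q"] that by auto
      then show ?thesis using that assms by (simp add: free_action_diff)
    qed
    have z: "(y \<oplus>\<^bsub>R\<^esub> z) \<ominus>\<^bsub>R\<^esub> y \<ominus>\<^bsub>R\<^esub> z = \<zero>\<^bsub>R\<^esub>" if "y \<in> carrier R" "z \<in> carrier R" for y z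
      using that by algebra
    from that show ?thesis unfolding tensor_relations_def
      using assms(1,3) by (auto simp: * free_action_of l_distr r_distr z)
  qed
  have "k \<in> generate (add_monoid ?F) (tensor_relations R ?S)"
    using assms(2) by (simp only: tensor_kernel_def)
  then have "Poly_Mapping.keys k \<subseteq> ?C \<and> free_action R k x = \<zero>\<^bsub>R\<^esub>"
  proof (induction rule: generate.induct)
    case one
    then show ?case using assms by (simp add: free_action_zero)
  next
    case (incl h)
    then show ?case using sub rel by auto
  next
    case (inv h)
    then have h: "Poly_Mapping.keys h \<subseteq> ?C" using sub by auto
    then have "inv\<^bsub>add_monoid ?F\<^esub> h = 0 - h" unfolding add_monoid_tensor_free by simp
    then show ?case using h rel inv assms free_action_diff[of R 0 h x]
      by (simp add: free_action_zero a_minus_def)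
  next
    case (eng h1 h2)
    then show ?case using keys_add[of h1 h2] assms by (auto simp: free_action_add)
  qed
  then show ?thesis ..
qed

lemma regular_bimodule_simps [simp]:
  "carrier (regular_bimodule R) = carrier R" "\<zero>\<^bsub>regular_bimodule R\<^esub> = \<zero>\<^bsub>R\<^esub>"
  "x \<oplus>\<^bsub>regular_bimodule R\<^esub> y = x \<oplus>\<^bsub>R\<^esub> y" "add (regular_bimodule R) = add R"
  by (simp_all add: regular_bimodule_def)

lemma smult_coset:
  assumes "ring R" "Poly_Mapping.keys u \<subseteq> carrier R \<times> carrier R" "x \<in> carrier R"
  shows "(tensor_kernel R (opposite_ring R) +>\<^bsub>tensor_free R (opposite_ring R)\<^esub> u)
    \<odot>\<^bsub>regular_bimodule R\<^esub> x = free_action R u x"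
proof -
  interpret ring R by fact
  let ?S = "opposite_ring R"
  let ?K = "tensor_kernel R ?S" and ?F = "tensor_free R ?S"
  interpret K: ideal ?K ?F
    by (intro tensor_kernel_ideal ring_opposite_ring assms(1))
  have keys: "Poly_Mapping.keys k \<subseteq> carrier R \<times> carrier R" if "k \<in> ?K" for k
    using K.a_subset that by auto
  have "free_action R (k + u) x = free_action R u x" if "k \<in> ?K" for k
    using that keys[OF that] assms free_action_closed[OF assms]
    by (simp add: free_action_add free_action_kernel)
  moreover have "0 \<in> ?K" using additive_subgroup.zero_closed[OF K.is_additive_subgroup] by simp
  moreover have "?K +>\<^bsub>?F\<^esub> u = (\<lambda>k. k + u) ` ?K"
    by (auto simp: a_r_coset_def')
  ultimately have "(\<lambda>w. free_action R w x) ` (?K +>\<^bsub>?F\<^esub> u) = {free_action R u x}"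
    by force
  then show ?thesis by (simp add: regular_bimodule_def)
qed

lemma smult_pure_tensor:
  assumes "ring R" "a \<in> carrier R" "b \<in> carrier R" "x \<in> carrier R"
  shows "pure_tensor R (opposite_ring R) a b \<odot>\<^bsub>regular_bimodule R\<^esub> x = a \<otimes>\<^bsub>R\<^esub> x \<otimes>\<^bsub>R\<^esub> b"
  unfolding pure_tensor_def using assms by (simp add: smult_coset free_action_of)

lemma carrier_enveloping_ring:
  "carrier (enveloping_ring R) =
    {tensor_kernel R (opposite_ring R) +>\<^bsub>tensor_free R (opposite_ring R)\<^esub> u | u.
      Poly_Mapping.keys u \<subseteq> carrier R \<times> carrier R}"
  by (auto simp: enveloping_ring_def tensor_ring_def FactRing_def A_RCOSETS_def')

lemma pure_tensor_closed:
  "a \<in> carrier R \<Longrightarrow> b \<in> carrier R \<Longrightarrow>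
    pure_tensor R (opposite_ring R) a b \<in> carrier (enveloping_ring R)"
  unfolding carrier_enveloping_ring pure_tensor_def by force

lemma left_module_regular_bimodule:
  assumes "ring R"
  shows "left_module (enveloping_ring R) (regular_bimodule R)"
proof -
  interpret ring R by fact
  let ?S = "opposite_ring R" and ?T = "enveloping_ring R" and ?M = "regular_bimodule R"
  let ?K = "tensor_kernel R ?S" and ?F = "tensor_free R ?S" and ?C = "carrier R \<times> carrier R"
  interpret K: ideal ?K ?F
    by (intro tensor_kernel_ideal ring_opposite_ring assms(1))
  have M: "abelian_group ?M"
    by (rule abelian_groupI) (auto simp: a_ac intro: l_neg)
  have addT: "(?K +>\<^bsub>?F\<^esub> u) \<oplus>\<^bsub>?T\<^esub> (?K +>\<^bsub>?F\<^esub> v) = ?K +>\<^bsub>?F\<^esub> (u + v)"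
    if "Poly_Mapping.keys u \<subseteq> ?C" "Poly_Mapping.keys v \<subseteq> ?C" for u v
    using K.a_rcos_sum[of u v] that by (simp add: enveloping_ring_def tensor_ring_def FactRing_def)
  have multT: "(?K +>\<^bsub>?F\<^esub> u) \<otimes>\<^bsub>?T\<^esub> (?K +>\<^bsub>?F\<^esub> v) = ?K +>\<^bsub>?F\<^esub> (u \<otimes>\<^bsub>?F\<^esub> v)"
    if "Poly_Mapping.keys u \<subseteq> ?C" "Poly_Mapping.keys v \<subseteq> ?C" for u v
    using K.rcoset_mult_add[of u v] that by (simp add: enveloping_ring_def tensor_ring_def FactRing_def)
  have oneT: "\<one>\<^bsub>?T\<^esub> = pure_tensor R ?S \<one>\<^bsub>R\<^esub> \<one>\<^bsub>R\<^esub>"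
    by (simp add: enveloping_ring_def tensor_ring_def FactRing_def pure_tensor_def)
  have add_keys: "Poly_Mapping.keys (u + v) \<subseteq> ?C"
    if "Poly_Mapping.keys u \<subseteq> ?C" "Poly_Mapping.keys v \<subseteq> ?C" for u v
    using keys_add[of u v] that by auto
  have mult_keys: "Poly_Mapping.keys (u \<otimes>\<^bsub>?F\<^esub> v) \<subseteq> ?C"
    if "Poly_Mapping.keys u \<subseteq> ?C" "Poly_Mapping.keys v \<subseteq> ?C" for u v
    using K.m_closed[of u v] that by simp
  have "left_module_axioms ?T ?M"
  proof
    fix a x assume "a \<in> carrier ?T" "x \<in> carrier ?M"
    then show "a \<odot>\<^bsub>?M\<^esub> x \<in> carrier ?M"
      using assms by (auto simp: carrier_enveloping_ring smult_coset free_action_closed)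
  next
    fix a b x assume "a \<in> carrier ?T" "b \<in> carrier ?T" "x \<in> carrier ?M"
    then obtain u v where "a = ?K +>\<^bsub>?F\<^esub> u" "b = ?K +>\<^bsub>?F\<^esub> v" and
      k: "Poly_Mapping.keys u \<subseteq> ?C" "Poly_Mapping.keys v \<subseteq> ?C" and x: "x \<in> carrier R"
      by (auto simp: carrier_enveloping_ring)
    then show "(a \<oplus>\<^bsub>?T\<^esub> b) \<odot>\<^bsub>?M\<^esub> x = a \<odot>\<^bsub>?M\<^esub> x \<oplus>\<^bsub>?M\<^esub> b \<odot>\<^bsub>?M\<^esub> x"
      and "(a \<otimes>\<^bsub>?T\<^esub> b) \<odot>\<^bsub>?M\<^esub> x = a \<odot>\<^bsub>?M\<^esub> (b \<odot>\<^bsub>?M\<^esub> x)"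
      using assms
      by (simp_all add: addT multT smult_coset add_keys mult_keys free_action_add free_action_mult
          free_action_closed)
  next
    fix a x y assume "a \<in> carrier ?T" "x \<in> carrier ?M" "y \<in> carrier ?M"
    then show "a \<odot>\<^bsub>?M\<^esub> (x \<oplus>\<^bsub>?M\<^esub> y) = a \<odot>\<^bsub>?M\<^esub> x \<oplus>\<^bsub>?M\<^esub> a \<odot>\<^bsub>?M\<^esub> y"
      using assms by (auto simp: carrier_enveloping_ring smult_coset free_action_distrib)
  next
    fix x assume "x \<in> carrier ?M"
    then show "\<one>\<^bsub>?T\<^esub> \<odot>\<^bsub>?M\<^esub> x = x"
      using assms by (simp add: oneT smult_pure_tensor)
  qed
  then show ?thesis
    by (intro left_module.intro ring_enveloping_ring assms M)
qed

lemma submodule_regular_bimodule_iff: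
  assumes "ring R"
  shows "submodule I (enveloping_ring R) (regular_bimodule R) \<longleftrightarrow> ideal I R"
proof -
  interpret ring R by fact
  let ?S = "opposite_ring R" and ?T = "enveloping_ring R" and ?M = "regular_bimodule R"
  let ?C = "carrier R \<times> carrier R"
  interpret M: left_module ?T ?M by (rule left_module_regular_bimodule[OF assms])
  show ?thesis
  proof
    assume sub: "submodule I ?T ?M"
    then have sg: "subgroup I (add_monoid ?M)" by (rule submodule.axioms)
    have IR: "I \<subseteq> carrier R" using subgroup.subset[OF sg] by simp
    have mult: "x \<otimes>\<^bsub>R\<^esub> a \<otimes>\<^bsub>R\<^esub> y \<in> I" if "a \<in> I" "x \<in> carrier R" "y \<in> carrier R" for a x y
      using submodule.smult_closed[OF sub pure_tensor_closed[OF that(2,3)] that(1)] IR that assms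
      by (auto simp: smult_pure_tensor subset_iff)
    show "ideal I R"
    proof (rule idealI)
      show "subgroup I (add_monoid R)"
      proof (rule add.subgroupI)
        show "I \<noteq> {}" using subgroup.one_closed[OF sg] by auto
        fix a b assume a: "a \<in> I" and b: "b \<in> I"
        have "\<ominus>\<^bsub>R\<^esub> a = \<ominus>\<^bsub>R\<^esub> \<one>\<^bsub>R\<^esub> \<otimes>\<^bsub>R\<^esub> a \<otimes>\<^bsub>R\<^esub> \<one>\<^bsub>R\<^esub>" using a IR by (auto simp: l_minus subset_iff)
        then show "\<ominus>\<^bsub>R\<^esub> a \<in> I" using mult[OF a] by simp
        show "a \<oplus>\<^bsub>R\<^esub> b \<in> I" using subgroup.m_closed[OF sg a b] by simp
      qed (rule IR)
      fix a x assume "a \<in> I" "x \<in> carrier R"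
      then show "x \<otimes>\<^bsub>R\<^esub> a \<in> I" "a \<otimes>\<^bsub>R\<^esub> x \<in> I"
        using mult[of a x "\<one>\<^bsub>R\<^esub>"] mult[of a "\<one>\<^bsub>R\<^esub>" x] IR by (auto simp: subset_iff)
    qed (rule assms)
  next
    assume "ideal I R"
    then interpret I: ideal I R .
    have act: "free_action R u x \<in> I" if "Poly_Mapping.keys u \<subseteq> ?C" "x \<in> I" for u x
      using that(1)
    proof (induction u rule: frag_induction_keys)
      case zero
      show ?case by (simp add: free_action_zero assms)
    next
      case (one p)
      then show ?case using that(2) assms
        by (cases p) (auto simp: free_action_of I.I_l_closed I.I_r_closed)
    next
      case (diff a b)
      then show ?case using that(2) assms
        by (simp add: free_action_diff a_minus_def)
    qed
    have minus: "\<ominus>\<^bsub>?M\<^esub> x = \<ominus>\<^bsub>R\<^esub> x" if "x \<in> carrier R" for x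
      by (rule M.M.minus_equality) (use that in \<open>simp_all add: l_neg\<close>)
    have "subgroup I (add_monoid ?M)"
    proof (rule M.M.add.subgroupI)
      show "I \<noteq> {}" using I.zero_closed by blast
    qed (auto simp: minus)
    then show "submodule I ?T ?M"
      by (intro submodule.intro submodule_axioms.intro)
        (use assms act in \<open>auto simp: carrier_enveloping_ring smult_coset\<close>)
  qed
qed

lemma subring_ring_center:
  assumes "ring R" shows "subring (ring_center R) R"
proof -
  interpret ring R by fact
  show ?thesis
  proof (rule subringI)
    fix a b assume "a \<in> ring_center R" "b \<in> ring_center R"
    then have a: "a \<in> carrier R" "\<And>r. r \<in> carrier R \<Longrightarrow> a \<otimes>\<^bsub>R\<^esub> r = r \<otimes>\<^bsub>R\<^esub> a"
      and b: "b \<in> carrier R" "\<And>r. r \<in> carrier R \<Longrightarrow> b \<otimes>\<^bsub>R\<^esub> r = r \<otimes>\<^bsub>R\<^esub> b"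
      by (simp_all add: ring_center_def)
    have "a \<otimes>\<^bsub>R\<^esub> b \<otimes>\<^bsub>R\<^esub> r = r \<otimes>\<^bsub>R\<^esub> (a \<otimes>\<^bsub>R\<^esub> b)" if r: "r \<in> carrier R" for r
    proof -
      have "a \<otimes>\<^bsub>R\<^esub> b \<otimes>\<^bsub>R\<^esub> r = a \<otimes>\<^bsub>R\<^esub> (r \<otimes>\<^bsub>R\<^esub> b)" using a(1) b r by (simp add: m_assoc)
      also have "\<dots> = r \<otimes>\<^bsub>R\<^esub> a \<otimes>\<^bsub>R\<^esub> b"
        using a(1) b(1) r by (simp only: m_assoc[symmetric] a(2)[OF r])
      finally show ?thesis using a(1) b(1) r by (simp add: m_assoc)
    qed
    with a(1) b(1) show "a \<otimes>\<^bsub>R\<^esub> b \<in> ring_center R" by (simp add: ring_center_def)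
    show "a \<oplus>\<^bsub>R\<^esub> b \<in> ring_center R" using a b by (simp add: ring_center_def l_distr r_distr)
  qed (auto simp: ring_center_def l_minus r_minus)
qed

end

theory Submission
  imports Defs
begin

text \<open>A bimodule endomorphism of \<open>R\<close> is multiplication by the central element \<open>f 1\<close>. Hence
  \<open>N * L\<close> is generated by the products of elements of \<open>N\<close> with central elements of \<open>L\<close>.\<close>

text \<open>On a generator \<open>frag_of (a, b)\<close> the claim is
  \<open>a x c b = a x b c\<close>, which holds because \<open>c\<close> commutes with
  \<open>b\<close>. Both sides respect differences in \<open>u\<close>, so induction gives the rest.
  This is the linearity of right multiplication by \<open>c\<close>.\<close>

lemma free_action_mult_central:
  assumes "ring R" "c \<in> ring_center R" "x \<in> carrier R"
    and "Poly_Mapping.keys u \<subseteq> carrier R \<times> carrier R"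
  shows "free_action R u (x \<otimes>\<^bsub>R\<^esub> c) = free_action R u x \<otimes>\<^bsub>R\<^esub> c"
proof -
  interpret ring R by fact
  have c: "c \<in> carrier R" "\<And>r. r \<in> carrier R \<Longrightarrow> c \<otimes>\<^bsub>R\<^esub> r = r \<otimes>\<^bsub>R\<^esub> c"
    using assms(2) by (simp_all add: ring_center_def)
  from assms(4) show ?thesis
  proof (induction u rule: frag_induction_keys)
    case zero
    show ?case using assms(1) c(1) by (simp add: free_action_zero)
  next
    case (one p)
    then show ?case using assms(1,3) c
      by (cases p) (auto simp: free_action_of m_assoc)
  next
    case (diff a b)
    then show ?case using assms(1,3) c(1)
      by (simp add: free_action_diff free_action_closed a_minus_def l_distr l_minus)
  qed
qed

text \<open>The values lie in \<open>L\<close> because \<open>L\<close> absorbs left factors, and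
  centrality of \<open>c\<close> gives linearity over the enveloping ring. Together with the next
  lemma this describes all bimodule maps from \<open>R\<close> to \<open>L\<close>.\<close>

lemma mult_central_in_Hom_mod:
  assumes "ring R" "ideal L R" "c \<in> L" "c \<in> ring_center R"
  shows "(\<lambda>x. x \<otimes>\<^bsub>R\<^esub> c) \<in>
    Hom_mod (enveloping_ring R) (regular_bimodule R) ((regular_bimodule R)\<lparr>carrier := L\<rparr>)"
proof -
  interpret ring R by fact
  interpret L: ideal L R by fact
  have "c \<in> carrier R" using assms(3) by (rule L.Icarr)
  then show ?thesis
    using assms(1,3,4)
    by (auto simp: Hom_mod_def hom_def l_distr L.I_l_closed carrier_enveloping_ring
        smult_coset free_action_mult_central)
qed

text \<open>The element is \<open>c = f 1\<close>. Linearity over the pure tensors of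
  \<open>x\<close> with 1 and of 1 with \<open>x\<close>, applied at 1, gives
  \<open>f x = x (f 1)\<close> and \<open>f x = (f 1) x\<close>; comparing the two makes
  \<open>f 1\<close> central.\<close>

lemma Hom_mod_regular_bimoduleE:
  assumes "ring R" "L \<subseteq> carrier R"
    and "f \<in> Hom_mod (enveloping_ring R) (regular_bimodule R) ((regular_bimodule R)\<lparr>carrier := L\<rparr>)"
  obtains c where "c \<in> L" "c \<in> ring_center R" "\<And>x. x \<in> carrier R \<Longrightarrow> f x = x \<otimes>\<^bsub>R\<^esub> c"
proof
  interpret ring R by fact
  have cl: "f x \<in> L" if "x \<in> carrier R" for x
    using assms(3) that by (auto simp: Hom_mod_def hom_def)
  \<comment> \<open>The pure tensor of \<open>a\<close> and \<open>b\<close> acts as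
    \<open>x\<close> to \<open>a x b\<close>, both on \<open>R\<close> and on the values of
    \<open>f\<close>, which lie in \<open>L\<close> and hence in \<open>R\<close>.\<close>
  have lin: "f (a \<otimes>\<^bsub>R\<^esub> x \<otimes>\<^bsub>R\<^esub> b) = a \<otimes>\<^bsub>R\<^esub> f x \<otimes>\<^bsub>R\<^esub> b"
    if "a \<in> carrier R" "b \<in> carrier R" "x \<in> carrier R" for a b x
  proof -
    have "f (pure_tensor R (opposite_ring R) a b \<odot>\<^bsub>regular_bimodule R\<^esub> x) =
        pure_tensor R (opposite_ring R) a b \<odot>\<^bsub>regular_bimodule R\<^esub> f x"
      using assms(3) that pure_tensor_closed[OF that(1,2)] by (simp add: Hom_mod_def)
    then show ?thesis
      using that cl assms(1,2) by (simp add: smult_pure_tensor subset_iff)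
  qed
  show "f \<one>\<^bsub>R\<^esub> \<in> L" using cl by simp
  then have one: "f \<one>\<^bsub>R\<^esub> \<in> carrier R" using assms(2) by blast
  show left: "f x = x \<otimes>\<^bsub>R\<^esub> f \<one>\<^bsub>R\<^esub>" if "x \<in> carrier R" for x
    using lin[of x "\<one>\<^bsub>R\<^esub>" "\<one>\<^bsub>R\<^esub>"] that one by simp
  \<comment> \<open>Here \<open>x\<close> is taken as the right-hand factor of the pure tensor,
    while \<open>left\<close> took it as the left-hand factor.\<close>
  have "f x = f \<one>\<^bsub>R\<^esub> \<otimes>\<^bsub>R\<^esub> x" if "x \<in> carrier R" for x
    using lin[of "\<one>\<^bsub>R\<^esub>" x "\<one>\<^bsub>R\<^esub>"] that one by simp
  with left have "f \<one>\<^bsub>R\<^esub> \<otimes>\<^bsub>R\<^esub> x = x \<otimes>\<^bsub>R\<^esub> f \<one>\<^bsub>R\<^esub>" if "x \<in> carrier R" for x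
    using that by metis
  with one show "f \<one>\<^bsub>R\<^esub> \<in> ring_center R"
    unfolding ring_center_def by blast
qed

text \<open>The two generating sets already coincide: each bimodule map into \<open>L\<close> is
  multiplication by a central element of \<open>L\<close>, and each such element gives a
  map.\<close>

lemma star_prod_regular_bimodule:
  assumes "ring R" "ideal N R" "ideal L R"
  shows "star_prod (enveloping_ring R) (regular_bimodule R) N L =
    generate (add_monoid (regular_bimodule R)) {x \<otimes>\<^bsub>R\<^esub> c | x c. x \<in> N \<and> c \<in> L \<inter> ring_center R}"
proof -
  let ?H = "Hom_mod (enveloping_ring R) (regular_bimodule R) ((regular_bimodule R)\<lparr>carrier := L\<rparr>)"
  interpret N: ideal N R by fact
  interpret L: ideal L R by fact
  have "(\<Union>f \<in> ?H. f ` N) = {x \<otimes>\<^bsub>R\<^esub> c | x c. x \<in> N \<and> c \<in> L \<inter> ring_center R}"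
  proof (intro subset_antisym subsetI)
    fix y assume "y \<in> (\<Union>f \<in> ?H. f ` N)"
    then obtain f x where f: "f \<in> ?H" and x: "x \<in> N" and y: "y = f x" by blast
    from assms(1) L.a_subset f obtain c
      where "c \<in> L" "c \<in> ring_center R" "\<And>x. x \<in> carrier R \<Longrightarrow> f x = x \<otimes>\<^bsub>R\<^esub> c"
      by (rule Hom_mod_regular_bimoduleE) blast
    then show "y \<in> {x \<otimes>\<^bsub>R\<^esub> c | x c. x \<in> N \<and> c \<in> L \<inter> ring_center R}"
      using x y N.Icarr by blast
  next
    fix y assume "y \<in> {x \<otimes>\<^bsub>R\<^esub> c | x c. x \<in> N \<and> c \<in> L \<inter> ring_center R}"
    then show "y \<in> (\<Union>f \<in> ?H. f ` N)"
      using mult_central_in_Hom_mod[OF assms(1,3)] by blast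
  qed
  then show ?thesis by (simp only: star_prod_def)
qed

lemma star_prod_regular_bimodule_eq_zero_iff:
  assumes "ring R" "ideal N R" "ideal L R"
  shows "star_prod (enveloping_ring R) (regular_bimodule R) N L = {\<zero>\<^bsub>R\<^esub>} \<longleftrightarrow>
    (\<forall>x \<in> N. \<forall>c \<in> L \<inter> ring_center R. x \<otimes>\<^bsub>R\<^esub> c = \<zero>\<^bsub>R\<^esub>)"
    (is "_ \<longleftrightarrow> ?zero")
proof -
  interpret M: left_module "enveloping_ring R" "regular_bimodule R"
    by (rule left_module_regular_bimodule[OF assms(1)])
  let ?A = "{x \<otimes>\<^bsub>R\<^esub> c | x c. x \<in> N \<and> c \<in> L \<inter> ring_center R}"
  let ?G = "generate (add_monoid (regular_bimodule R)) ?A"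
  have "?G = {\<zero>\<^bsub>R\<^esub>} \<longleftrightarrow> ?zero"
  proof
    assume "?G = {\<zero>\<^bsub>R\<^esub>}"
    then have "?A \<subseteq> {\<zero>\<^bsub>R\<^esub>}"
      using generate.incl[of _ ?A "add_monoid (regular_bimodule R)"] by blast
    then show ?zero by blast
  next
    assume ?zero
    then have "?A \<subseteq> {\<zero>\<^bsub>R\<^esub>}" by blast
    moreover have "subgroup {\<zero>\<^bsub>R\<^esub>} (add_monoid (regular_bimodule R))"
      using M.M.add.triv_subgroup by simp
    ultimately have "?G \<subseteq> {\<zero>\<^bsub>R\<^esub>}"
      by (rule M.M.add.generate_subgroup_incl)
    then show "?G = {\<zero>\<^bsub>R\<^esub>}"
      using generate.one[of "add_monoid (regular_bimodule R)" ?A] by auto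
  qed
  then show ?thesis by (simp only: star_prod_regular_bimodule[OF assms])
qed

text \<open>Restates primeness purely in terms of ideals and central elements; from here on the
  tensor product no longer appears inside the arguments.\<close>

lemma star_prime_regular_bimodule_iff:
  assumes "ring R"
  shows "star_prime (enveloping_ring R) (regular_bimodule R) \<longleftrightarrow>
    (\<forall>N L. ideal N R \<longrightarrow> ideal L R \<longrightarrow> N \<noteq> {\<zero>\<^bsub>R\<^esub>} \<longrightarrow> L \<noteq> {\<zero>\<^bsub>R\<^esub>} \<longrightarrow>
      (\<exists>x \<in> N. \<exists>c \<in> L \<inter> ring_center R. x \<otimes>\<^bsub>R\<^esub> c \<noteq> \<zero>\<^bsub>R\<^esub>))"
  using star_prod_regular_bimodule_eq_zero_iff[OF assms]
  by (simp add: star_prime_def left_module_regular_bimodule submodule_regular_bimodule_iff assms)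

text \<open>The left multiples of a central \<open>c\<close> also absorb factors on the right, since
  \<open>(r c) x = (r x) c\<close>.\<close>

lemma ideal_central_multiples:
  assumes "ring R" "c \<in> ring_center R"
  shows "ideal ((\<lambda>r. r \<otimes>\<^bsub>R\<^esub> c) ` carrier R) R"
proof -
  interpret ring R by fact
  have c: "c \<in> carrier R" "\<And>r. r \<in> carrier R \<Longrightarrow> c \<otimes>\<^bsub>R\<^esub> r = r \<otimes>\<^bsub>R\<^esub> c"
    using assms(2) by (simp_all add: ring_center_def)
  show ?thesis
  proof (rule idealI)
    show "subgroup ((\<lambda>r. r \<otimes>\<^bsub>R\<^esub> c) ` carrier R) (add_monoid R)"
    proof (rule add.subgroupI)
      fix a b assume "a \<in> (\<lambda>r. r \<otimes>\<^bsub>R\<^esub> c) ` carrier R" "b \<in> (\<lambda>r. r \<otimes>\<^bsub>R\<^esub> c) ` carrier R"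
      then obtain r s where rs: "r \<in> carrier R" "s \<in> carrier R" "a = r \<otimes>\<^bsub>R\<^esub> c" "b = s \<otimes>\<^bsub>R\<^esub> c"
        by blast
      show "\<ominus>\<^bsub>R\<^esub> a \<in> (\<lambda>r. r \<otimes>\<^bsub>R\<^esub> c) ` carrier R"
        using rs c(1) by (intro image_eqI[of _ _ "\<ominus>\<^bsub>R\<^esub> r"]) (simp_all add: l_minus)
      show "a \<oplus>\<^bsub>R\<^esub> b \<in> (\<lambda>r. r \<otimes>\<^bsub>R\<^esub> c) ` carrier R"
        using rs c(1) by (intro image_eqI[of _ _ "r \<oplus>\<^bsub>R\<^esub> s"]) (simp_all add: l_distr)
    qed (use c(1) in auto)
    fix a x assume "a \<in> (\<lambda>r. r \<otimes>\<^bsub>R\<^esub> c) ` carrier R" and x: "x \<in> carrier R"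
    then obtain r where r: "r \<in> carrier R" "a = r \<otimes>\<^bsub>R\<^esub> c" by blast
    show "x \<otimes>\<^bsub>R\<^esub> a \<in> (\<lambda>r. r \<otimes>\<^bsub>R\<^esub> c) ` carrier R"
      using r x c(1) by (intro image_eqI[of _ _ "x \<otimes>\<^bsub>R\<^esub> r"]) (simp_all add: m_assoc)
    show "a \<otimes>\<^bsub>R\<^esub> x \<in> (\<lambda>r. r \<otimes>\<^bsub>R\<^esub> c) ` carrier R"
      using r x c by (intro image_eqI[of _ _ "r \<otimes>\<^bsub>R\<^esub> x"]) (simp_all add: m_assoc)
  qed (rule assms(1))
qed

text \<open>The center is a commutative subring and 1 is non-zero by assumption, so only the absence
  of zero divisors remains of the domain axioms.\<close>

lemma domain_ring_center_iff:
  assumes "ring R" "\<one>\<^bsub>R\<^esub> \<noteq> \<zero>\<^bsub>R\<^esub>"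
  shows "domain (R\<lparr>carrier := ring_center R\<rparr>) \<longleftrightarrow>
    (\<forall>a \<in> ring_center R. \<forall>b \<in> ring_center R. a \<otimes>\<^bsub>R\<^esub> b = \<zero>\<^bsub>R\<^esub> \<longrightarrow> a = \<zero>\<^bsub>R\<^esub> \<or> b = \<zero>\<^bsub>R\<^esub>)"
proof -
  interpret ring R by fact
  have "subcring (ring_center R) R"
    using subring_ring_center[OF assms(1)]
    by (rule subcringI) (unfold ring_center_def, blast)
  then show ?thesis
    using assms(2) subdomain_iff[OF subcringE(1)]
    unfolding subdomain_def subdomain_axioms_def by blast
qed

theorem mainTheorem1:
  fixes R :: "('a, 'm) ring_scheme"
  assumes "ring R"
    and "\<one>\<^bsub>R\<^esub> \<noteq> \<zero>\<^bsub>R\<^esub>"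
  shows "star_prime (enveloping_ring R) (regular_bimodule R) \<longleftrightarrow>
    domain (R\<lparr>carrier := ring_center R\<rparr>) \<and> large_subring (ring_center R) R"
proof -
  interpret ring R by fact
  let ?C = "ring_center R"
  have CR: "c \<in> carrier R" if "c \<in> ?C" for c using that by (simp add: ring_center_def)
  show ?thesis
  proof (intro iffI conjI)
    assume "star_prime (enveloping_ring R) (regular_bimodule R)"
    then have prime: "\<exists>x \<in> N. \<exists>c \<in> L \<inter> ?C. x \<otimes>\<^bsub>R\<^esub> c \<noteq> \<zero>\<^bsub>R\<^esub>"
      if "ideal N R" "ideal L R" "N \<noteq> {\<zero>\<^bsub>R\<^esub>}" "L \<noteq> {\<zero>\<^bsub>R\<^esub>}" for N L
      using that assms(1) by (simp add: star_prime_regular_bimodule_iff)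
    show "large_subring ?C R"
      unfolding large_subring_def
    proof (intro conjI allI impI)
      fix I assume "ideal I R" "I \<noteq> {\<zero>\<^bsub>R\<^esub>}"
      \<comment> \<open>Primeness is applied with \<open>N\<close> the whole ring and
        \<open>L = I\<close>; the central factor \<open>c\<close> of a non-zero product is the
        required element of \<open>I\<close>.\<close>
      moreover have "carrier R \<noteq> {\<zero>\<^bsub>R\<^esub>}" using assms(2) one_closed by blast
      ultimately obtain x c where "x \<in> carrier R" "c \<in> I \<inter> ?C" "x \<otimes>\<^bsub>R\<^esub> c \<noteq> \<zero>\<^bsub>R\<^esub>"
        using prime[OF oneideal] by blast
      moreover from this have "c \<noteq> \<zero>\<^bsub>R\<^esub>" by auto
      ultimately show "\<exists>x \<in> I \<inter> ?C. x \<noteq> \<zero>\<^bsub>R\<^esub>" by blast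
    qed (rule subring_ring_center[OF assms(1)])
    have "a = \<zero>\<^bsub>R\<^esub> \<or> b = \<zero>\<^bsub>R\<^esub>" if a: "a \<in> ?C" and b: "b \<in> ?C" and ab: "a \<otimes>\<^bsub>R\<^esub> b = \<zero>\<^bsub>R\<^esub>" for a b
    proof (rule ccontr)
      assume nz: "\<not> (a = \<zero>\<^bsub>R\<^esub> \<or> b = \<zero>\<^bsub>R\<^esub>)"
      \<comment> \<open>Primeness is applied to the ideals \<open>R a\<close> and
        \<open>R b\<close>, which are non-zero because they contain \<open>a\<close> and
        \<open>b\<close>.\<close>
      let ?I = "\<lambda>c. (\<lambda>r. r \<otimes>\<^bsub>R\<^esub> c) ` carrier R"
      have mem: "c \<in> ?I c" if "c \<in> ?C" for c
        using CR[OF that] by (intro image_eqI[of _ _ "\<one>\<^bsub>R\<^esub>"]) simp_all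
      have "?I a \<noteq> {\<zero>\<^bsub>R\<^esub>}" "?I b \<noteq> {\<zero>\<^bsub>R\<^esub>}" using mem[OF a] mem[OF b] nz by auto
      then obtain r s where rs: "r \<in> carrier R" "s \<in> carrier R"
        and ne: "(r \<otimes>\<^bsub>R\<^esub> a) \<otimes>\<^bsub>R\<^esub> (s \<otimes>\<^bsub>R\<^esub> b) \<noteq> \<zero>\<^bsub>R\<^esub>"
        using prime[OF ideal_central_multiples ideal_central_multiples, OF assms(1) a assms(1) b] by blast
      \<comment> \<open>Moving \<open>s\<close> past the central \<open>b\<close> brings
        \<open>a\<close> and \<open>b\<close> together: \<open>r a s b = r (a b) s\<close>, which
        vanishes.\<close>
      have "s \<otimes>\<^bsub>R\<^esub> b = b \<otimes>\<^bsub>R\<^esub> s" using b rs by (simp add: ring_center_def)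
      then have "(r \<otimes>\<^bsub>R\<^esub> a) \<otimes>\<^bsub>R\<^esub> (s \<otimes>\<^bsub>R\<^esub> b) = r \<otimes>\<^bsub>R\<^esub> (a \<otimes>\<^bsub>R\<^esub> b) \<otimes>\<^bsub>R\<^esub> s"
        using rs CR[OF a] CR[OF b] by (simp add: m_assoc)
      with ne ab rs show False by simp
    qed
    then show "domain (R\<lparr>carrier := ?C\<rparr>)"
      using assms by (simp add: domain_ring_center_iff)
  next
    assume "domain (R\<lparr>carrier := ?C\<rparr>) \<and> large_subring ?C R"
    then have nzd: "\<And>a b. a \<in> ?C \<Longrightarrow> b \<in> ?C \<Longrightarrow> a \<otimes>\<^bsub>R\<^esub> b = \<zero>\<^bsub>R\<^esub> \<Longrightarrow> a = \<zero>\<^bsub>R\<^esub> \<or> b = \<zero>\<^bsub>R\<^esub>"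
      and large: "\<And>I. ideal I R \<Longrightarrow> I \<noteq> {\<zero>\<^bsub>R\<^esub>} \<Longrightarrow> \<exists>x \<in> I \<inter> ?C. x \<noteq> \<zero>\<^bsub>R\<^esub>"
      using assms by (auto simp: domain_ring_center_iff large_subring_def)
    show "star_prime (enveloping_ring R) (regular_bimodule R)"
      unfolding star_prime_regular_bimodule_iff[OF assms(1)]
    proof (intro allI impI)
      fix N L assume "ideal N R" "ideal L R" "N \<noteq> {\<zero>\<^bsub>R\<^esub>}" "L \<noteq> {\<zero>\<^bsub>R\<^esub>}"
      \<comment> \<open>Largeness supplies a non-zero central element in each ideal;
        \<open>a\<close> then serves as the element of \<open>N\<close> and \<open>b\<close> as the
        central multiplier from \<open>L\<close>.\<close>
      then obtain a b where a: "a \<in> N \<inter> ?C" "a \<noteq> \<zero>\<^bsub>R\<^esub>" and b: "b \<in> L \<inter> ?C" "b \<noteq> \<zero>\<^bsub>R\<^esub>"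
        using large[of N] large[of L] by auto
      then have "a \<otimes>\<^bsub>R\<^esub> b \<noteq> \<zero>\<^bsub>R\<^esub>" using nzd[of a b] by auto
      with a(1) b(1) show "\<exists>x \<in> N. \<exists>c \<in> L \<inter> ?C. x \<otimes>\<^bsub>R\<^esub> c \<noteq> \<zero>\<^bsub>R\<^esub>" by blast
    qed
  qed
qed

end
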